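(* Let the plant $\dot x=f(x,u)$ with steady-state map $h:\mathbb{R}^p\to\mathbb{R}^n$ satisfy the Plant Assumption, and let $W:\mathbb{R}^n\times\mathbb{R}^p\to\mathbb{R}$ be a Lyapunov function for the plant with constants $\alpha,\beta,\gamma,\zeta>0$ as defined in the context. Let $g:\mathbb{R}^{n+p+r}\to\mathbb{R}^p$ and $k:\mathbb{R}^{n+p+r}\to\mathbb{R}^r$, and set $\tilde g(u,z):=g(h(u),u,z)$, $\tilde k(u,z):=k(h(u),u,z)$. Assume: (i) there is $L>0$ such that for all $x,x'\in\mathbb{R}^n$, $u\in\mathbb{R}^p$, $z\in\mathbb{R}^r$, $$\left\|\begin{bmatrix} g(x',u,z) \\ k(x',u,z) \end{bmatrix}-\begin{bmatrix} g(x,u,z) \\ k(x,u,z) \end{bmatrix}\right\|\le L\|x'-x\|;$$ (ii) there is $\ell>0$ such that for all $u,u'\in\mathbb{R}^p$, $z,z'\in\mathbb{R}^r$, $$\left\|\begin{bmatrix} \tilde g(u',z') \\ \tilde k(u',z') \end{bmatrix}-\begin{bmatrix} \tilde g(u,z) \\ \tilde k(u,z) \end{bmatrix}\right\|\le\ell\left\|\begin{bmatrix} u' \\ z' \end{bmatrix}-\begin{bmatrix} u \\ z \end{bmatrix}\right\|;$$ (iii) the reduced system $\dot u=\tilde g(u,z)$, $\dot z=\tilde k(u,z)$ has a unique equilibrium $(u^\star,z^\star)$, and there exist a differentiable function $V:\mathbb{R}^p\times\mathbb{R}^r\to\mathbb{R}$, positive definite with respect to $(u^\star,z^\star)$, and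 $\kappa,\mu>0$ such that for all $(u,z)$, with $e(u,z):=\begin{bmatrix} u-u^\star \\ z-z^\star \end{bmatrix}$, $$\nabla V(u,z)\begin{bmatrix} \tilde g(u,z) \\ \tilde k(u,z) \end{bmatrix}\le-\mu\|e(u,z)\|^2,\qquad \|\nabla V(u,z)\|\le\kappa\|e(u,z)\|.$$ If $\epsilon>0$ satisfies $$\epsilon<\frac{\gamma}{\zeta L\left(1+\frac{\kappa\ell}{\mu}\right)},$$ then all trajectories of $$\dot x=f(x,u),\qquad\dot u=\epsilon\,g(x,u,z),\qquad\dot z=\epsilon\,k(x,u,z)$$ converge asymptotically to $(x^\star,u^\star,z^\star)$, where $x^\star:=h(u^\star)$.
   Context: Notation: $\nabla$ denotes the Jacobian (a row vector for scalar functions); $\|\cdot\|$ is the Euclidean norm. $V$ positive definite with respect to $(u^\star,z^\star)$ means $V(u^\star,z^\star)=0$ and $V(u,z)>0$ otherwise. Plant Assumption: $f:\mathbb{R}^n\times\mathbb{R}^p\to\mathbb{R}^n$ is continuously differentiable, Lipschitz in $x$ and Lipschitz in $u$ (with uniform constants). The map $h:\mathbb{R}^p\to\mathbb{R}^n$ is differentiable, Lipschitz, and satisfies $f(h(u),u)=0$ for all $u\in\mathbb{R}^p$. There exist $\tau,K>0$ such that for every $x_0\in\mathbb{R}^n$ and every constant $\hat u\in\mathbb{R}^p$ the solution of $\dot x=f(x,\hat u)$, $x(0)=x_0$, satisfies $\|x(t)-h(\hat u)\|\le K\|x_0-h(\hat u)\|e^{-\tau t}$ for all $t\ge 0$. Lyapunov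 function $W$ with constants $\alpha,\beta,\gamma,\zeta>0$: $W$ is differentiable and for all $(x,u)$: $\alpha\|x-h(u)\|^2\le W(x,u)\le\beta\|x-h(u)\|^2$, $\ \nabla_xW(x,u)f(x,u)\le-\gamma\|x-h(u)\|^2$, $\ \|\nabla_uW(x,u)\|\le\zeta\|x-h(u)\|$. A trajectory is a complete solution, i.e. a continuously differentiable function on $[0,\infty)$ satisfying the differential equations for all $t\ge0$. *)

theory Defs
  imports "HOL-Analysis.Analysis"
begin

text \<open>
  Stacked vectors are pairs: the norm and inner product of a product type are the Euclidean ones,
  so \<^term>\<open>norm (u, z)\<close> is the norm of the column vector with blocks \<open>u\<close> and \<open>z\<close>.

  The Jacobian of a scalar function is the row vector of its partial derivatives. It is represented
  by the vector \<open>grad \<phi> x\<close> with these entries; the product of the row with a column vector \<open>v\<close>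
  is then \<open>grad \<phi> x \<bullet> v\<close>. It is meaningful only where \<open>\<phi>\<close> is differentiable.
\<close>

definition grad :: "('a::euclidean_space \<Rightarrow> real) \<Rightarrow> 'a \<Rightarrow> 'a" where
  "grad \<phi> x = (\<Sum>b\<in>Basis. frechet_derivative \<phi> (at x) b *\<^sub>R b)"

lemma grad_inner:
  assumes "\<phi> differentiable (at x)"
  shows "grad \<phi> x \<bullet> v = frechet_derivative \<phi> (at x) v"
proof -
  have lin: "linear (frechet_derivative \<phi> (at x))"
    using assms by (rule linear_frechet_derivative)
  have "frechet_derivative \<phi> (at x) v = frechet_derivative \<phi> (at x) (\<Sum>b\<in>Basis. (v \<bullet> b) *\<^sub>R b)"
    by (simp add: euclidean_representation)
  also have "\<dots> = (\<Sum>b\<in>Basis. (v \<bullet> b) * frechet_derivative \<phi> (at x) b)"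
    by (simp add: linear_sum[OF lin] linear_cmul[OF lin])
  also have "\<dots> = grad \<phi> x \<bullet> v"
    by (simp add: grad_def inner_sum_left inner_commute[of v] mult.commute)
  finally show ?thesis by simp
qed

definition continuously_differentiable ::
    "('a::real_normed_vector \<Rightarrow> 'b::real_normed_vector) \<Rightarrow> bool" where
  "continuously_differentiable F \<longleftrightarrow>
     (\<exists>F' :: 'a \<Rightarrow> 'a \<Rightarrow>\<^sub>L 'b. (\<forall>y. (F has_derivative blinfun_apply (F' y)) (at y)) \<and>
        continuous_on UNIV F')"

text \<open>
  Complete solutions of \<open>y' = F y\<close>. The derivative at \<open>0\<close> is one-sided. Continuity of the
  derivative is required explicitly since \<open>F\<close> need not be continuous.
\<close>

definition trajectory :: "('a::real_normed_vector \<Rightarrow> 'a) \<Rightarrow> (real \<Rightarrow> 'a) \<Rightarrow> bool" where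
  "trajectory F y \<longleftrightarrow>
     (\<exists>y'. continuous_on {0..} y' \<and>
        (\<forall>t\<ge>0. (y has_vector_derivative y' t) (at t within {0..}) \<and> y' t = F (y t)))"

definition plant_assumption ::
    "((real^'n) \<times> (real^'p) \<Rightarrow> real^'n) \<Rightarrow> (real^'p \<Rightarrow> real^'n) \<Rightarrow> bool" where
  "plant_assumption f h \<longleftrightarrow>
     continuously_differentiable f \<and>
     (\<exists>C. \<forall>u. C-lipschitz_on UNIV (\<lambda>x. f (x, u))) \<and>
     (\<exists>C. \<forall>x. C-lipschitz_on UNIV (\<lambda>u. f (x, u))) \<and>
     h differentiable_on UNIV \<and>
     (\<exists>C. C-lipschitz_on UNIV h) \<and>
     (\<forall>u. f (h u, u) = 0) \<and>
     (\<exists>\<tau> K. \<tau> > 0 \<and> K > 0 \<and>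
        (\<forall>x0 u x. trajectory (\<lambda>x. f (x, u)) x \<and> x 0 = x0 \<longrightarrow>
           (\<forall>t\<ge>0. norm (x t - h u) \<le> K * norm (x0 - h u) * exp (- \<tau> * t))))"

definition plant_lyapunov ::
    "((real^'n) \<times> (real^'p) \<Rightarrow> real^'n) \<Rightarrow> (real^'p \<Rightarrow> real^'n) \<Rightarrow>
     real \<Rightarrow> real \<Rightarrow> real \<Rightarrow> real \<Rightarrow> ((real^'n) \<times> (real^'p) \<Rightarrow> real) \<Rightarrow> bool" where
  "plant_lyapunov f h \<alpha> \<beta> \<gamma> \<zeta> W \<longleftrightarrow>
     \<alpha> > 0 \<and> \<beta> > 0 \<and> \<gamma> > 0 \<and> \<zeta> > 0 \<and>
     W differentiable_on UNIV \<and>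
     (\<forall>x u. \<alpha> * (norm (x - h u))\<^sup>2 \<le> W (x, u) \<and> W (x, u) \<le> \<beta> * (norm (x - h u))\<^sup>2 \<and>
        grad (\<lambda>x. W (x, u)) x \<bullet> f (x, u) \<le> - \<gamma> * (norm (x - h u))\<^sup>2 \<and>
        norm (grad (\<lambda>u. W (x, u)) u) \<le> \<zeta> * norm (x - h u))"

definition reduced ::
    "('p \<Rightarrow> 'n) \<Rightarrow> ('n \<times> 'p \<times> 'r \<Rightarrow> 'b) \<Rightarrow> 'p \<times> 'r \<Rightarrow> 'b" where
  "reduced h G = (\<lambda>(u, z). G (h u, u, z))"

definition equilibrium :: "('a::real_normed_vector \<Rightarrow> 'a) \<Rightarrow> 'a \<Rightarrow> bool" where
  "equilibrium F y \<longleftrightarrow> F y = 0"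

definition positive_definite_wrt :: "('a \<Rightarrow> real) \<Rightarrow> 'a \<Rightarrow> bool" where
  "positive_definite_wrt V y \<longleftrightarrow> V y = 0 \<and> (\<forall>w. w \<noteq> y \<longrightarrow> V w > 0)"

end

theory Submission
  imports Defs
begin

text \<open>
  Along a trajectory write \<open>a = \<parallel>x - h(u)\<parallel>\<close> for the distance of the plant from its steady state
  and \<open>b = \<parallel>(u - u\<^sup>\<star>, z - z\<^sup>\<star>)\<parallel>\<close> for the error of the controller. Replacing \<open>x\<close> by \<open>h(u)\<close> in
  \<open>(g, k)\<close> changes its value by at most \<open>L a\<close>, and \<open>(g, k)\<close> at \<open>x = h(u)\<close> has norm at most \<open>l b\<close>
  because it vanishes at the equilibrium. The two Lyapunov functions thus satisfy
  \<open>W' \<le> -\<gamma> a\<^sup>2 + \<epsilon> \<zeta> a (L a + l b)\<close> and \<open>V' \<le> \<epsilon> (-\<mu> b\<^sup>2 + \<kappa> L a b)\<close>.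

  In \<open>U = W + \<nu> V\<close> with \<open>\<nu> = \<zeta> l / (\<kappa> L)\<close> the two cross terms become equal, and the bound on
  \<open>U'\<close> is the quadratic form \<open>-(\<gamma> - \<epsilon> \<zeta> L) a\<^sup>2 + 2 \<epsilon> \<zeta> l a b - \<epsilon> \<nu> \<mu> b\<^sup>2\<close>. The
  condition on its discriminant is exactly the assumed bound on \<open>\<epsilon>\<close>, so \<open>U' \<le> -c (a\<^sup>2 + b\<^sup>2)\<close> for
  some \<open>c > 0\<close> (\<open>quadratic_form_coercive\<close>).

  No growth of \<open>V\<close> at infinity is assumed, so convergence is not read off from sublevel sets of \<open>U\<close>.
  Instead, the decay of \<open>U\<close> says that \<open>a\<^sup>2 + b\<^sup>2\<close> is integrable in time, while
  \<open>\<phi> = W + b\<^sup>2\<close> is comparable to \<open>a\<^sup>2 + b\<^sup>2\<close> and has \<open>\<phi>' \<le> C (a\<^sup>2 + b\<^sup>2)\<close>. A nonnegative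
  integrable quantity that cannot grow faster than its own size tends to \<open>0\<close>
  (\<open>dissipated_tendsto_zero\<close>, an argument in the style of Barbalat). Hence \<open>a\<close> and \<open>b\<close> tend to
  \<open>0\<close>, and \<open>x\<close> follows \<open>h(u)\<close> to \<open>h(u\<^sup>\<star>)\<close>.
\<close>


section \<open>Dissipation inequalities on the half-line\<close>

lemma nonincreasing_of_derivative:
  fixes F F' :: "real \<Rightarrow> real"
  assumes deriv: "\<And>r. r \<ge> 0 \<Longrightarrow> (F has_real_derivative F' r) (at r within {0..})"
    and nonpos: "\<And>r. r \<ge> s \<Longrightarrow> F' r \<le> 0"
    and "0 \<le> s" "s \<le> t"
  shows "F t \<le> F s"
proof (rule DERIV_nonpos_imp_decreasing_open[OF \<open>s \<le> t\<close>])
  fix r assume r: "s < r" "r < t"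
  with \<open>0 \<le> s\<close> have "at r within {0..} = at r"
    by (intro at_within_interior) (simp add: interior_real_atLeast)
  then show "\<exists>y. (F has_real_derivative y) (at r) \<and> y \<le> 0"
    using deriv[of r] nonpos[of r] r \<open>0 \<le> s\<close> by auto
next
  have "continuous_on {0..} F"
    by (rule DERIV_continuous_on) (use deriv in auto)
  then show "continuous_on {s..t} F"
    by (rule continuous_on_subset) (use \<open>0 \<le> s\<close> in auto)
qed

lemma nonincreasing_convergent_at_top:
  fixes F :: "real \<Rightarrow> real"
  assumes mono: "\<And>s t. 0 \<le> s \<Longrightarrow> s \<le> t \<Longrightarrow> F t \<le> F s"
    and bound: "\<And>t. t \<ge> 0 \<Longrightarrow> F t \<ge> 0"
  shows "\<exists>m. (F \<longlongrightarrow> m) at_top"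
proof -
  have bdd: "bdd_below (F ` {0..})"
    using bound by (auto simp: bdd_below_def)
  have "(F \<longlongrightarrow> (INF t\<in>{0..}. F t)) at_top"
  proof (rule decreasing_tendsto)
    show "\<forall>\<^sub>F t in at_top. (INF t\<in>{0..}. F t) \<le> F t"
      using eventually_ge_at_top[of 0]
      by eventually_elim (rule cINF_lower[OF bdd], simp)
  next
    fix v assume "(INF t\<in>{0..}. F t) < v"
    then obtain s where s: "s \<ge> 0" "F s < v"
      using cINF_less_iff[OF _ bdd] by auto
    show "\<forall>\<^sub>F t in at_top. F t < v"
      using eventually_ge_at_top[of s]
      by eventually_elim (use s mono[of s] in \<open>force intro: le_less_trans\<close>)
  qed
  then show ?thesis ..
qed

text \<open>
  Both \<open>U\<close> and \<open>\<phi> + (C/c) U\<close> are nonincreasing and nonnegative, so \<open>\<phi>\<close> has a limit. If the limit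
  were positive, \<open>s\<close> would stay above a positive constant and \<open>U\<close> would fall below \<open>0\<close>.
\<close>

lemma dissipated_tendsto_zero:
  fixes U U' \<phi> \<phi>' s :: "real \<Rightarrow> real"
  assumes U: "\<And>t. t \<ge> 0 \<Longrightarrow> (U has_real_derivative U' t) (at t within {0..})"
    and \<phi>: "\<And>t. t \<ge> 0 \<Longrightarrow> (\<phi> has_real_derivative \<phi>' t) (at t within {0..})"
    and c: "c > 0" and C: "C > 0" and D: "D > 0"
    and U_nonneg: "\<And>t. t \<ge> 0 \<Longrightarrow> U t \<ge> 0"
    and U_decay: "\<And>t. t \<ge> 0 \<Longrightarrow> U' t \<le> - c * s t"
    and \<phi>_growth: "\<And>t. t \<ge> 0 \<Longrightarrow> \<phi>' t \<le> C * s t"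
    and \<phi>_nonneg: "\<And>t. t \<ge> 0 \<Longrightarrow> \<phi> t \<ge> 0"
    and \<phi>_le: "\<And>t. t \<ge> 0 \<Longrightarrow> \<phi> t \<le> D * s t"
  shows "(\<phi> \<longlongrightarrow> 0) at_top"
proof -
  have s_nonneg: "s t \<ge> 0" if "t \<ge> 0" for t
    using order_trans[OF \<phi>_nonneg[OF that] \<phi>_le[OF that]] D
    by (simp add: zero_le_mult_iff)
  have "U t \<le> U r" if "0 \<le> r" "r \<le> t" for r t
  proof (rule nonincreasing_of_derivative[OF U _ that])
    fix t :: real assume "t \<ge> r"
    with \<open>0 \<le> r\<close> have "t \<ge> 0" by simp
    then have "c * s t \<ge> 0" using s_nonneg c by simp
    with U_decay[OF \<open>t \<ge> 0\<close>] show "U' t \<le> 0" by simp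
  qed
  then obtain m where m: "(U \<longlongrightarrow> m) at_top"
    using nonincreasing_convergent_at_top[of U] U_nonneg by blast
  define P where "P = (\<lambda>t. \<phi> t + C / c * U t)"
  have "P t \<le> P r" if "0 \<le> r" "r \<le> t" for r t
  proof (rule nonincreasing_of_derivative[where F' = "\<lambda>t. \<phi>' t + C / c * U' t", OF _ _ that])
    fix t :: real assume t: "t \<ge> 0"
    show "(P has_real_derivative \<phi>' t + C / c * U' t) (at t within {0..})"
      unfolding P_def by (intro DERIV_add DERIV_cmult U \<phi> t)
  next
    fix t :: real assume "t \<ge> r"
    with \<open>0 \<le> r\<close> have t: "t \<ge> 0" by simp
    have "C / c * U' t \<le> C / c * (- c * s t)"
      using U_decay[OF t] c C by (intro mult_left_mono) auto
    also have "\<dots> = - C * s t" using c by simp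
    finally show "\<phi>' t + C / c * U' t \<le> 0" using \<phi>_growth[OF t] by simp
  qed
  moreover have "P t \<ge> 0" if "t \<ge> 0" for t
    using \<phi>_nonneg[OF that] U_nonneg[OF that] c C by (simp add: P_def)
  ultimately obtain q where q: "(P \<longlongrightarrow> q) at_top"
    using nonincreasing_convergent_at_top[of P] by blast
  define v where "v = q - C / c * m"
  have "((\<lambda>t. P t - C / c * U t) \<longlongrightarrow> v) at_top"
    unfolding v_def by (intro tendsto_intros q m)
  then have v: "(\<phi> \<longlongrightarrow> v) at_top" by (simp add: P_def)
  have "v \<ge> 0"
    by (rule tendsto_lowerbound[OF v])
      (auto intro: eventually_mono[OF eventually_ge_at_top[of 0]] \<phi>_nonneg)
  moreover have "\<not> v > 0"
  proof
    assume "v > 0"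
    then have "\<forall>\<^sub>F t in at_top. \<phi> t > v / 2"
      by (intro order_tendstoD(1)[OF v]) simp
    then obtain T0 where T0: "\<And>t. t \<ge> T0 \<Longrightarrow> \<phi> t > v / 2"
      by (auto simp: eventually_at_top_linorder)
    define T where "T = max T0 0"
    define \<delta> where "\<delta> = c * (v / (2 * D))"
    have T: "T \<ge> 0" by (simp add: T_def)
    have \<delta>: "\<delta> > 0" using c D \<open>v > 0\<close> by (simp add: \<delta>_def)
    have rate: "U' t \<le> - \<delta>" if "t \<ge> T" for t
    proof -
      have t: "t \<ge> 0" "t \<ge> T0" using that by (auto simp: T_def)
      have "v / 2 < D * s t" using T0[OF t(2)] \<phi>_le[OF t(1)] by simp
      then have "v / (2 * D) \<le> s t" using D by (simp add: field_simps)
      then have "\<delta> \<le> c * s t" unfolding \<delta>_def using c by (intro mult_left_mono) auto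
      then show ?thesis using U_decay[OF t(1)] by simp
    qed
    define t where "t = T + (U T / \<delta> + 1)"
    have "t \<ge> T" using U_nonneg[OF T] \<delta> by (simp add: t_def)
    have "U t + \<delta> * t \<le> U T + \<delta> * T"
    proof (rule nonincreasing_of_derivative[where F' = "\<lambda>r. U' r + \<delta> * 1", OF _ _ T \<open>t \<ge> T\<close>])
      fix r :: real assume r: "r \<ge> 0"
      show "((\<lambda>r. U r + \<delta> * r) has_real_derivative U' r + \<delta> * 1) (at r within {0..})"
        by (intro DERIV_add DERIV_cmult U r DERIV_ident)
    qed (use rate in force)
    moreover have "\<delta> * t = \<delta> * T + U T + \<delta>" using \<delta> by (simp add: t_def field_simps)
    ultimately have "U t < 0" using \<delta> by simp
    with U_nonneg[of t] T \<open>t \<ge> T\<close> show False by simp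
  qed
  ultimately have "v = 0" by linarith
  with v show ?thesis by simp
qed

text \<open>
  With \<open>c = (A D - B\<^sup>2) / (A + D)\<close> the determinant \<open>(A - c) (D - c) - B\<^sup>2\<close> equals \<open>c\<^sup>2\<close>, so
  subtracting \<open>c\<close> times the identity leaves the form positive semidefinite.
\<close>

lemma quadratic_form_coercive:
  fixes A B D :: real
  assumes A: "A > 0" and D: "D > 0" and det: "B\<^sup>2 < A * D"
  obtains c where "c > 0" "\<And>a b. c * (a\<^sup>2 + b\<^sup>2) \<le> A * a\<^sup>2 - 2 * B * a * b + D * b\<^sup>2"
proof
  define c where "c = (A * D - B\<^sup>2) / (A + D)"
  show "(A * D - B\<^sup>2) / (A + D) > 0" using A D det by simp
  have c: "c * (A + D) = A * D - B\<^sup>2" using A D by (simp add: c_def)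
  have "A * D - B\<^sup>2 < A * (A + D)"
    using zero_le_power2[of B] mult_pos_pos[OF A A] unfolding distrib_left by linarith
  then have Ac: "A - c > 0" using A D by (simp add: c_def divide_less_eq)
  have disc: "(A - c) * (D - c) - B\<^sup>2 = c\<^sup>2"
    using c by (simp add: algebra_simps power2_eq_square)
  fix a b :: real
  let ?Q = "A * a\<^sup>2 - 2 * B * a * b + D * b\<^sup>2 - c * (a\<^sup>2 + b\<^sup>2)"
  have "(A - c) * ?Q = ((A - c) * a - B * b)\<^sup>2 + ((A - c) * (D - c) - B\<^sup>2) * b\<^sup>2"
    by (simp add: algebra_simps power2_eq_square)
  also have "\<dots> \<ge> 0" unfolding disc by simp
  finally have "?Q \<ge> 0" using Ac by (simp add: zero_le_mult_iff)
  then show "(A * D - B\<^sup>2) / (A + D) * (a\<^sup>2 + b\<^sup>2) \<le> A * a\<^sup>2 - 2 * B * a * b + D * b\<^sup>2"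
    by (simp add: c_def)
qed


section \<open>Gradients along curves\<close>

lemma has_real_derivative_along_curve:
  fixes \<phi> :: "'a::euclidean_space \<Rightarrow> real"
  assumes "\<phi> differentiable (at (y t))" "(y has_vector_derivative v) (at t within S)"
  shows "((\<lambda>r. \<phi> (y r)) has_real_derivative grad \<phi> (y t) \<bullet> v) (at t within S)"
proof -
  have "(\<phi> has_derivative frechet_derivative \<phi> (at (y t))) (at (y t))"
    using assms(1) by (simp add: frechet_derivative_works)
  then have "(\<phi> has_derivative frechet_derivative \<phi> (at (y t))) (at (y t) within y ` S)"
    by (rule has_derivative_at_withinI)
  from vector_derivative_diff_chain_within[OF assms(2) this] show ?thesis
    unfolding o_def grad_inner[OF assms(1)] has_real_derivative_iff_has_vector_derivative .
qed

text \<open>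
  The hypotheses on \<open>W\<close> bound its two partial gradients separately. Joint differentiability lets
  these bounds control the derivative of \<open>W\<close> along a trajectory, where both blocks move at once.
\<close>

lemma grad_Pair_inner:
  fixes \<phi> :: "'a::euclidean_space \<times> 'b::euclidean_space \<Rightarrow> real"
  assumes diff: "\<phi> differentiable (at (x, u))"
  shows "grad \<phi> (x, u) \<bullet> (p, q) = grad (\<lambda>x. \<phi> (x, u)) x \<bullet> p + grad (\<lambda>u. \<phi> (x, u)) u \<bullet> q"
proof -
  let ?D = "frechet_derivative \<phi> (at (x, u))"
  have D: "(\<phi> has_derivative ?D) (at (x, u))"
    using diff by (simp add: frechet_derivative_works)
  have 1: "((\<lambda>x. \<phi> (x, u)) has_derivative (\<lambda>p. ?D (p, 0))) (at x)"
    by (rule has_derivative_compose[where f = "\<lambda>x. (x, u)", OF _ D])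
      (auto intro!: derivative_eq_intros)
  have 2: "((\<lambda>u. \<phi> (x, u)) has_derivative (\<lambda>q. ?D (0, q))) (at u)"
    by (rule has_derivative_compose[where f = "\<lambda>u. (x, u)", OF _ D])
      (auto intro!: derivative_eq_intros)
  have "?D (p, q) = ?D ((p, 0) + (0, q))" by simp
  also have "\<dots> = ?D (p, 0) + ?D (0, q)"
    by (rule linear_add[OF linear_frechet_derivative[OF diff]])
  finally show ?thesis
    using grad_inner[OF diff, of "(p, q)"]
      grad_inner[OF differentiableI[OF 1], of p] frechet_derivative_at[OF 1]
      grad_inner[OF differentiableI[OF 2], of q] frechet_derivative_at[OF 2]
    by (simp add: fun_eq_iff)
qed


lemma trajectory_has_derivative:
  assumes "trajectory F y" "t \<ge> 0"
  shows "(y has_vector_derivative F (y t)) (at t within {0..})"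
  using assms by (auto simp: trajectory_def)


section \<open>Convergence of the interconnection\<close>

theorem theoremV1:
  fixes f :: "(real^'n) \<times> (real^'p) \<Rightarrow> real^'n"
    and h :: "real^'p \<Rightarrow> real^'n"
    and W :: "(real^'n) \<times> (real^'p) \<Rightarrow> real"
    and g :: "(real^'n) \<times> (real^'p) \<times> (real^'r) \<Rightarrow> real^'p"
    and k :: "(real^'n) \<times> (real^'p) \<times> (real^'r) \<Rightarrow> real^'r"
    and V :: "(real^'p) \<times> (real^'r) \<Rightarrow> real"
    and ustar :: "real^'p" and zstar :: "real^'r"
    and \<alpha> \<beta> \<gamma> \<zeta> L l \<kappa> \<mu> \<epsilon> :: real
  assumes plant: "plant_assumption f h"
    and W: "plant_lyapunov f h \<alpha> \<beta> \<gamma> \<zeta> W"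
    and L: "L > 0"
      "\<And>x x' u z. norm ((g (x', u, z), k (x', u, z)) - (g (x, u, z), k (x, u, z)))
         \<le> L * norm (x' - x)"
    and l: "l > 0"
      "\<And>u u' z z'. norm ((reduced h g (u', z'), reduced h k (u', z'))
           - (reduced h g (u, z), reduced h k (u, z)))
         \<le> l * norm ((u', z') - (u, z))"
    and equil: "equilibrium (\<lambda>w. (reduced h g w, reduced h k w)) (ustar, zstar)"
      "\<And>w. equilibrium (\<lambda>w. (reduced h g w, reduced h k w)) w \<Longrightarrow> w = (ustar, zstar)"
    and V: "V differentiable_on UNIV" "positive_definite_wrt V (ustar, zstar)"
    and \<kappa>\<mu>: "\<kappa> > 0" "\<mu> > 0"
    and V_decrease: "\<And>u z. grad V (u, z) \<bullet> (reduced h g (u, z), reduced h k (u, z))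
         \<le> - \<mu> * (norm (u - ustar, z - zstar))\<^sup>2"
    and V_grad: "\<And>u z. norm (grad V (u, z)) \<le> \<kappa> * norm (u - ustar, z - zstar)"
    and \<epsilon>: "\<epsilon> > 0" "\<epsilon> < \<gamma> / (\<zeta> * L * (1 + \<kappa> * l / \<mu>))"
  shows "\<forall>y. trajectory (\<lambda>(x, u, z). (f (x, u), \<epsilon> *\<^sub>R g (x, u, z), \<epsilon> *\<^sub>R k (x, u, z))) y
           \<longrightarrow> (y \<longlongrightarrow> (h ustar, ustar, zstar)) at_top"
proof (intro allI impI)
  fix y assume traj: "trajectory (\<lambda>(x, u, z). (f (x, u), \<epsilon> *\<^sub>R g (x, u, z), \<epsilon> *\<^sub>R k (x, u, z))) y"
  define X where "X = (\<lambda>t. fst (y t))"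
  define w where "w = (\<lambda>t. snd (y t))"
  define u where "u = (\<lambda>t. fst (w t))"
  have y_eq: "y t = (X t, w t)" for t by (simp add: X_def w_def)
  define G where "G = (\<lambda>x w. (g (x, w), k (x, w)))"
  define wstar where "wstar = (ustar, zstar)"
  define a where "a = (\<lambda>t. norm (X t - h (u t)))"
  define b where "b = (\<lambda>t. norm (w t - wstar))"
  have nonneg: "a t \<ge> 0" "b t \<ge> 0" for t by (simp_all add: a_def b_def)

  have y_deriv: "(y has_vector_derivative (f (X t, u t), \<epsilon> *\<^sub>R G (X t) (w t))) (at t within {0..})"
    if "t \<ge> 0" for t
  proof -
    have "(y has_vector_derivative
        (case y t of (x, u, z) \<Rightarrow> (f (x, u), \<epsilon> *\<^sub>R g (x, u, z), \<epsilon> *\<^sub>R k (x, u, z)))) (at t within {0..})"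
      using trajectory_has_derivative[OF traj that] .
    moreover have "(case y t of (x, u, z) \<Rightarrow> (f (x, u), \<epsilon> *\<^sub>R g (x, u, z), \<epsilon> *\<^sub>R k (x, u, z)))
        = (f (X t, u t), \<epsilon> *\<^sub>R G (X t) (w t))"
      by (simp add: X_def w_def u_def G_def split: prod.splits)
    ultimately show ?thesis by (simp only:)
  qed
  have w_deriv: "(w has_vector_derivative \<epsilon> *\<^sub>R G (X t) (w t)) (at t within {0..})"
    if "t \<ge> 0" for t
    using bounded_linear.has_vector_derivative[OF bounded_linear_snd y_deriv[OF that]]
    by (simp add: w_def)
  have Xu_deriv: "((\<lambda>t. (X t, u t)) has_vector_derivative
      (f (X t, u t), fst (\<epsilon> *\<^sub>R G (X t) (w t)))) (at t within {0..})" if "t \<ge> 0" for t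
    using has_vector_derivative_Pair
      [OF bounded_linear.has_vector_derivative[OF bounded_linear_fst y_deriv[OF that]]
        bounded_linear.has_vector_derivative[OF bounded_linear_fst w_deriv[OF that]]]
    by (simp add: X_def u_def)

  have W_pos: "\<alpha> > 0" "\<beta> > 0" "\<gamma> > 0" "\<zeta> > 0"
    and W_diff: "W differentiable (at (x, v))"
    and W_bounds: "\<alpha> * (norm (x - h v))\<^sup>2 \<le> W (x, v)" "W (x, v) \<le> \<beta> * (norm (x - h v))\<^sup>2"
    and W_decrease: "grad (\<lambda>x. W (x, v)) x \<bullet> f (x, v) \<le> - \<gamma> * (norm (x - h v))\<^sup>2"
    and W_grad: "norm (grad (\<lambda>v. W (x, v)) v) \<le> \<zeta> * norm (x - h v)" for x v
    using W by (auto simp: plant_lyapunov_def differentiable_on_def)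
  have h_cont: "continuous_on UNIV h"
    using plant by (auto simp: plant_assumption_def intro: lipschitz_on_continuous_on)

  define R where "R = (\<lambda>t. G (h (u t)) (w t))"
  have reduced_G: "(reduced h g v, reduced h k v) = G (h (fst v)) v" for v
    by (cases v) (simp add: reduced_def G_def)
  have fast_error: "norm (G (X t) (w t) - R t) \<le> L * a t" for t
    using L(2)[of "X t" "fst (w t)" "snd (w t)" "h (u t)"]
    by (simp add: G_def R_def a_def u_def)
  have R_bound: "norm (R t) \<le> l * b t" for t
    using l(2)[of "fst (w t)" "snd (w t)" ustar zstar] equil(1)
    by (simp add: reduced_G R_def b_def u_def wstar_def equilibrium_def)
  have G_bound: "norm (G (X t) (w t)) \<le> L * a t + l * b t" for t
    using norm_triangle_ineq[of "G (X t) (w t) - R t" "R t"] fast_error[of t] R_bound[of t] by simp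

  define W' where "W' = (\<lambda>t. grad W (X t, u t) \<bullet> (f (X t, u t), fst (\<epsilon> *\<^sub>R G (X t) (w t))))"
  define V' where "V' = (\<lambda>t. grad V (w t) \<bullet> (\<epsilon> *\<^sub>R G (X t) (w t)))"
  define E' where "E' = (\<lambda>t. 2 * ((w t - wstar) \<bullet> (\<epsilon> *\<^sub>R G (X t) (w t))))"
  have dW: "((\<lambda>t. W (X t, u t)) has_real_derivative W' t) (at t within {0..})" if "t \<ge> 0" for t
    unfolding W'_def using has_real_derivative_along_curve[OF W_diff Xu_deriv[OF that]] .
  have dV: "((\<lambda>t. V (w t)) has_real_derivative V' t) (at t within {0..})" if "t \<ge> 0" for t
    unfolding V'_def using V(1) w_deriv[OF that]
    by (intro has_real_derivative_along_curve) (simp_all add: differentiable_on_def del: split_paired_All)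
  have dE: "((\<lambda>t. (b t)\<^sup>2) has_real_derivative E' t) (at t within {0..})" if "t \<ge> 0" for t
  proof -
    have "((\<lambda>t. w t - wstar) has_derivative (\<lambda>r. r *\<^sub>R (\<epsilon> *\<^sub>R G (X t) (w t)))) (at t within {0..})"
      using w_deriv[OF that] unfolding has_vector_derivative_def
      by (auto intro!: derivative_eq_intros)
    note has_derivative_inner[OF this this]
    moreover have "(\<lambda>r. (w t - wstar) \<bullet> (r *\<^sub>R (\<epsilon> *\<^sub>R G (X t) (w t)))
        + (r *\<^sub>R (\<epsilon> *\<^sub>R G (X t) (w t))) \<bullet> (w t - wstar)) = (*) (E' t)"
      by (rule ext) (simp add: E'_def inner_commute[of "w t - wstar"])
    ultimately show ?thesis
      by (simp add: b_def power2_norm_eq_inner has_field_derivative_def)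
  qed

  have W'_le: "W' t \<le> - \<gamma> * (a t)\<^sup>2 + \<epsilon> * \<zeta> * a t * (L * a t + l * b t)" for t
  proof -
    let ?p = "grad (\<lambda>v. W (X t, v)) (u t)"
    have "?p \<bullet> fst (\<epsilon> *\<^sub>R G (X t) (w t)) \<le> norm ?p * norm (fst (\<epsilon> *\<^sub>R G (X t) (w t)))"
      by (rule norm_cauchy_schwarz)
    also have "\<dots> \<le> (\<zeta> * a t) * (\<epsilon> * (L * a t + l * b t))"
    proof (rule mult_mono)
      show "norm ?p \<le> \<zeta> * a t" using W_grad by (simp add: a_def)
      have "norm (fst (\<epsilon> *\<^sub>R G (X t) (w t))) \<le> norm (\<epsilon> *\<^sub>R G (X t) (w t))"
        by (metis norm_fst_le prod.collapse)
      also have "\<dots> \<le> \<epsilon> * (L * a t + l * b t)"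
        using \<epsilon>(1) G_bound[of t] by simp
      finally show "norm (fst (\<epsilon> *\<^sub>R G (X t) (w t))) \<le> \<epsilon> * (L * a t + l * b t)" .
    qed (use W_pos nonneg in auto)
    finally show ?thesis
      using W_decrease[of "u t" "X t"]
      by (simp add: W'_def grad_Pair_inner[OF W_diff] a_def mult_ac)
  qed
  have V'_le: "V' t \<le> \<epsilon> * (- \<mu> * (b t)\<^sup>2 + \<kappa> * b t * (L * a t))" for t
  proof -
    have "grad V (w t) \<bullet> (G (X t) (w t) - R t) \<le> norm (grad V (w t)) * norm (G (X t) (w t) - R t)"
      by (rule norm_cauchy_schwarz)
    also have "\<dots> \<le> (\<kappa> * b t) * (L * a t)"
      using V_grad[of "fst (w t)" "snd (w t)"] fast_error[of t] \<kappa>\<mu> nonneg[of t]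
      by (intro mult_mono) (auto simp: b_def wstar_def minus_prod_def)
    finally have "grad V (w t) \<bullet> (G (X t) (w t) - R t) \<le> \<kappa> * b t * (L * a t)" .
    moreover have "grad V (w t) \<bullet> R t \<le> - \<mu> * (b t)\<^sup>2"
      using V_decrease[of "fst (w t)" "snd (w t)"]
      by (simp add: reduced_G R_def u_def b_def wstar_def minus_prod_def)
    ultimately have "grad V (w t) \<bullet> G (X t) (w t) \<le> - \<mu> * (b t)\<^sup>2 + \<kappa> * b t * (L * a t)"
      by (simp add: inner_diff_right)
    from mult_left_mono[OF this, of \<epsilon>] \<epsilon>(1) show ?thesis by (simp add: V'_def)
  qed
  have E'_le: "E' t \<le> 2 * \<epsilon> * b t * (L * a t + l * b t)" for t
  proof -
    have "(w t - wstar) \<bullet> G (X t) (w t) \<le> b t * norm (G (X t) (w t))"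
      unfolding b_def by (rule norm_cauchy_schwarz)
    also have "\<dots> \<le> b t * (L * a t + l * b t)"
      using G_bound nonneg by (intro mult_left_mono)
    finally have "(w t - wstar) \<bullet> G (X t) (w t) \<le> b t * (L * a t + l * b t)" .
    from mult_left_mono[OF this, of "2 * \<epsilon>"] \<epsilon>(1) show ?thesis by (simp add: E'_def mult_ac)
  qed

  \<comment> \<open>This weight gives both off-diagonal contributions to \<open>U'\<close> the coefficient \<open>\<epsilon> \<zeta> l\<close>;
    it minimises the ratio of the squared off-diagonal term to the weight itself, hence the
    discriminant condition is as weak as possible.\<close>
  define \<nu> where "\<nu> = \<zeta> * l / (\<kappa> * L)"
  have \<nu>: "\<nu> > 0" "\<nu> * (\<kappa> * L) = \<zeta> * l" using W_pos L(1) l(1) \<kappa>\<mu> by (simp_all add: \<nu>_def)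
  have gap: "\<epsilon> * (\<zeta> * L) + \<epsilon> * (\<zeta> * L * \<kappa> * l / \<mu>) < \<gamma>"
  proof -
    have "\<zeta> * L * (1 + \<kappa> * l / \<mu>) > 0"
      using W_pos L(1) l(1) \<kappa>\<mu> by (intro mult_pos_pos add_pos_pos divide_pos_pos) auto
    then have "\<epsilon> * (\<zeta> * L * (1 + \<kappa> * l / \<mu>)) < \<gamma>"
      using \<epsilon>(2) by (simp add: pos_less_divide_eq)
    then show ?thesis by (simp add: algebra_simps)
  qed
  have diag: "\<gamma> - \<epsilon> * \<zeta> * L > 0" "\<epsilon> * \<nu> * \<mu> > 0"
  proof -
    have "\<epsilon> * (\<zeta> * L * \<kappa> * l / \<mu>) > 0"
      using W_pos L(1) l(1) \<kappa>\<mu> \<epsilon>(1) by simp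
    with gap show "\<gamma> - \<epsilon> * \<zeta> * L > 0" by (simp add: mult.assoc)
    show "\<epsilon> * \<nu> * \<mu> > 0" using \<nu> \<epsilon>(1) \<kappa>\<mu> by simp
  qed
  have "(\<epsilon> * \<zeta> * l)\<^sup>2 = \<epsilon> * (\<zeta> * L * \<kappa> * l / \<mu>) * (\<epsilon> * \<nu> * \<mu>)"
    using L(1) \<kappa>\<mu> by (simp add: \<nu>_def power2_eq_square)
  also have "\<dots> < (\<gamma> - \<epsilon> * \<zeta> * L) * (\<epsilon> * \<nu> * \<mu>)"
    using gap diag(2) by (intro mult_strict_right_mono) (auto simp: mult.assoc)
  finally obtain c where c: "c > 0" and coercive:
    "\<And>p q. c * (p\<^sup>2 + q\<^sup>2) \<le> (\<gamma> - \<epsilon> * \<zeta> * L) * p\<^sup>2 - 2 * (\<epsilon> * \<zeta> * l) * p * q + \<epsilon> * \<nu> * \<mu> * q\<^sup>2"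
    using quadratic_form_coercive[OF diag] by blast

  have ab_le: "a t * b t \<le> (a t)\<^sup>2 + (b t)\<^sup>2" for t
    using sum_squares_bound[of "a t" "b t"] nonneg[of t] mult_nonneg_nonneg[OF nonneg, of t t]
    by linarith
  have "((\<lambda>t. W (X t, u t) + (b t)\<^sup>2) \<longlongrightarrow> 0) at_top"
  proof (rule dissipated_tendsto_zero[where U = "\<lambda>t. W (X t, u t) + \<nu> * V (w t)"
        and s = "\<lambda>t. (a t)\<^sup>2 + (b t)\<^sup>2" and C = "\<epsilon> * \<zeta> * (L + l) + 2 * \<epsilon> * (L + l)"
        and D = "\<beta> + 1" and c = c])
    fix t :: real assume t: "t \<ge> 0"
    show "((\<lambda>t. W (X t, u t) + \<nu> * V (w t)) has_real_derivative W' t + \<nu> * V' t)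
        (at t within {0..})"
      by (intro DERIV_add DERIV_cmult dW dV t)
    show "((\<lambda>t. W (X t, u t) + (b t)\<^sup>2) has_real_derivative W' t + E' t) (at t within {0..})"
      by (intro DERIV_add dW dE t)
    have W_nonneg: "W (X t, u t) \<ge> 0"
      using order_trans[OF _ W_bounds(1)] W_pos by simp
    then show "W (X t, u t) + (b t)\<^sup>2 \<ge> 0" by simp
    have "V (w t) \<ge> 0"
      using V(2) unfolding positive_definite_wrt_def by (metis less_imp_le order_refl)
    with W_nonneg \<nu>(1) show "W (X t, u t) + \<nu> * V (w t) \<ge> 0" by simp
    show "W' t + \<nu> * V' t \<le> - c * ((a t)\<^sup>2 + (b t)\<^sup>2)"
    proof -
      have "\<nu> * V' t \<le> \<nu> * (\<epsilon> * (- \<mu> * (b t)\<^sup>2 + \<kappa> * b t * (L * a t)))"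
        using V'_le \<nu>(1) by (intro mult_left_mono) auto
      also have "\<dots> = - (\<epsilon> * \<nu> * \<mu>) * (b t)\<^sup>2 + \<epsilon> * (\<nu> * (\<kappa> * L)) * a t * b t"
        by (simp add: algebra_simps)
      also have "\<dots> = - (\<epsilon> * \<nu> * \<mu>) * (b t)\<^sup>2 + \<epsilon> * \<zeta> * l * a t * b t"
        by (simp add: \<nu>(2))
      finally show ?thesis
        using W'_le[of t] coercive[of "a t" "b t"]
        by (simp add: algebra_simps power2_eq_square)
    qed
    show "W' t + E' t \<le> (\<epsilon> * \<zeta> * (L + l) + 2 * \<epsilon> * (L + l)) * ((a t)\<^sup>2 + (b t)\<^sup>2)"
    proof -
      let ?s = "(a t)\<^sup>2 + (b t)\<^sup>2"
      have "a t * (L * a t + l * b t) = L * (a t)\<^sup>2 + l * (a t * b t)"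
        by (simp add: algebra_simps power2_eq_square)
      also have "\<dots> \<le> L * ?s + l * ?s"
        using L(1) l(1) ab_le by (intro add_mono mult_left_mono) auto
      finally have "\<epsilon> * \<zeta> * (a t * (L * a t + l * b t)) \<le> \<epsilon> * \<zeta> * (L * ?s + l * ?s)"
        using \<epsilon>(1) W_pos by (intro mult_left_mono) auto
      moreover have "b t * (L * a t + l * b t) = L * (a t * b t) + l * (b t)\<^sup>2"
        by (simp add: algebra_simps power2_eq_square)
      then have "b t * (L * a t + l * b t) \<le> L * ?s + l * ?s"
        using L(1) l(1) ab_le by (auto intro!: add_mono mult_left_mono)
      then have "2 * \<epsilon> * (b t * (L * a t + l * b t)) \<le> 2 * \<epsilon> * (L * ?s + l * ?s)"
        using \<epsilon>(1) by (intro mult_left_mono) auto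
      moreover have "\<gamma> * (a t)\<^sup>2 \<ge> 0" using W_pos by simp
      moreover have "(\<epsilon> * \<zeta> * (L + l) + 2 * \<epsilon> * (L + l)) * ?s
          = \<epsilon> * \<zeta> * (L * ?s + l * ?s) + 2 * \<epsilon> * (L * ?s + l * ?s)"
        by (simp add: algebra_simps)
      ultimately show ?thesis
        using W'_le[of t] E'_le[of t] by (simp add: mult.assoc)
    qed
    have "W (X t, u t) \<le> \<beta> * (a t)\<^sup>2" using W_bounds(2) by (simp add: a_def)
    moreover have "\<beta> * (b t)\<^sup>2 \<ge> 0" using W_pos by simp
    ultimately show "W (X t, u t) + (b t)\<^sup>2 \<le> (\<beta> + 1) * ((a t)\<^sup>2 + (b t)\<^sup>2)"
      by (simp add: distrib_left distrib_right add_increasing2)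
  qed (use c W_pos L(1) l(1) \<epsilon>(1) in \<open>auto intro!: add_pos_pos mult_pos_pos\<close>)
  note \<phi>_lim = this

  have "((\<lambda>t. (W (X t, u t) + (b t)\<^sup>2) / \<alpha>) \<longlongrightarrow> 0) at_top"
    using tendsto_divide[OF \<phi>_lim tendsto_const[of \<alpha>]] W_pos by simp
  then have "((\<lambda>t. (a t)\<^sup>2) \<longlongrightarrow> 0) at_top"
  proof (rule tendsto_sandwich[OF _ _ tendsto_const, rotated -1])
    show "\<forall>\<^sub>F t in at_top. (a t)\<^sup>2 \<le> (W (X t, u t) + (b t)\<^sup>2) / \<alpha>"
    proof (rule always_eventually, rule allI)
      fix t
      have "\<alpha> * (a t)\<^sup>2 \<le> W (X t, u t) + (b t)\<^sup>2"
        using W_bounds(1) by (simp add: a_def add_increasing2)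
      then show "(a t)\<^sup>2 \<le> (W (X t, u t) + (b t)\<^sup>2) / \<alpha>"
        using W_pos by (simp add: pos_le_divide_eq mult.commute)
    qed
  qed auto
  from tendsto_real_sqrt[OF this] have a_lim: "((\<lambda>t. X t - h (u t)) \<longlongrightarrow> 0) at_top"
    by (simp add: a_def tendsto_norm_zero_iff)
  have "((\<lambda>t. (b t)\<^sup>2) \<longlongrightarrow> 0) at_top"
  proof (rule tendsto_sandwich[OF _ _ tendsto_const \<phi>_lim])
    show "\<forall>\<^sub>F t in at_top. (b t)\<^sup>2 \<le> W (X t, u t) + (b t)\<^sup>2"
      using order_trans[OF _ W_bounds(1)] W_pos by simp
  qed simp
  from tendsto_real_sqrt[OF this] have "((\<lambda>t. w t - wstar) \<longlongrightarrow> 0) at_top"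
    by (simp add: b_def tendsto_norm_zero_iff)
  then have w_lim: "(w \<longlongrightarrow> wstar) at_top" by (rule LIM_zero_cancel)
  have "(u \<longlongrightarrow> ustar) at_top"
    using tendsto_fst[OF w_lim] by (simp add: u_def wstar_def)
  then have "((\<lambda>t. h (u t)) \<longlongrightarrow> h ustar) at_top"
    using continuous_on_tendsto_compose[OF h_cont] by simp
  from tendsto_add[OF a_lim this] have "(X \<longlongrightarrow> h ustar) at_top" by simp
  from tendsto_Pair[OF this w_lim] show "(y \<longlongrightarrow> (h ustar, ustar, zstar)) at_top"
    by (simp add: wstar_def y_eq[abs_def])
qed

end
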